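(* Let $n\geq 2$, $s>r\geq 1$ be integers, $d=\gcd(r,n,s)$, $R=r/d$, $N=n/d$, $S=s/d$, and suppose $S-R=1$. Then $$\mathcal{H}(r,n,s)^{\mathrm{ab}}\cong\left(\mathcal{H}(R,N,S)^{\mathrm{ab}}\right)^d\oplus\mathbb{Z}^{d-1}.$$
   Context: For an element $w=w(x_0,\dots,x_{n-1})$ of the free group on $x_0,\dots,x_{n-1}$, the cyclically presented group $G_n(w)$ is the group with presentation $\langle x_0,\dots,x_{n-1}\mid w(x_i,x_{i+1},\dots,x_{i+n-1})\ (0\le i<n)\rangle$, subscripts taken mod $n$. For $r,s,n\ge 1$, the generalized Fibonacci group is $\mathcal{H}(r,n,s)=G_n(w)$ with $w=x_0x_1\cdots x_{r-1}(x_rx_{r+1}\cdots x_{r+s-1})^{-1}$ (subscripts mod $n$). $G^{\mathrm{ab}}$ denotes the abelianization of $G$; $A^d$ denotes the direct sum of $d$ copies of $A$. *)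

theory Defs
  imports "HOL-Algebra.Algebra"
begin

text \<open>
  The free group on a set \<open>A\<close>, realised on freely reduced words. The letter
  \<open>(x, True)\<close> stands for the generator \<open>x\<close> and \<open>(x, False)\<close> for its inverse.
\<close>

type_synonym 'a word = "('a \<times> bool) list"

fun reduced :: "'a word \<Rightarrow> bool" where
  "reduced ((x, a) # (y, b) # u) \<longleftrightarrow> \<not> (x = y \<and> a \<noteq> b) \<and> reduced ((y, b) # u)"
| "reduced _ \<longleftrightarrow> True"

fun cons_reduce :: "'a \<times> bool \<Rightarrow> 'a word \<Rightarrow> 'a word" where
  "cons_reduce (x, a) ((y, b) # u) = (if x = y \<and> a \<noteq> b then u else (x, a) # (y, b) # u)"
| "cons_reduce l [] = [l]"

definition reduce :: "'a word \<Rightarrow> 'a word" where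
  "reduce u = foldr cons_reduce u []"

definition free_group :: "'a set \<Rightarrow> 'a word monoid" where
  "free_group A =
     \<lparr>carrier = {u \<in> lists (A \<times> UNIV). reduced u},
      monoid.mult = (\<lambda>u v. reduce (u @ v)),
      one = []\<rparr>"

definition free_gen :: "'a \<Rightarrow> 'a word" where
  "free_gen x = [(x, True)]"

definition normal_closure :: "('a, 'b) monoid_scheme \<Rightarrow> 'a set \<Rightarrow> 'a set" where
  "normal_closure G R =
     generate G {g \<otimes>\<^bsub>G\<^esub> a \<otimes>\<^bsub>G\<^esub> inv\<^bsub>G\<^esub> g | g a. g \<in> carrier G \<and> a \<in> R}"

definition presented_group :: "'a set \<Rightarrow> 'a word set \<Rightarrow> 'a word set monoid" where
  "presented_group A R = free_group A Mod normal_closure (free_group A) R"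

definition abelianization :: "('a, 'b) monoid_scheme \<Rightarrow> 'a set monoid" where
  "abelianization G = G Mod derived G (carrier G)"

text \<open>
  \<open>shift_word n i w\<close> is \<open>w(x\<^sub>i, x\<^sub>i\<^sub>+\<^sub>1, \<dots>, x\<^sub>i\<^sub>+\<^sub>n\<^sub>-\<^sub>1)\<close>, subscripts mod \<open>n\<close>: each generator
  \<open>x\<^sub>j\<close> in \<open>w\<close> is replaced by \<open>x\<^sub>i\<^sub>+\<^sub>j\<close>. For \<open>w\<close> in the free group on \<open>x\<^sub>0, \<dots>, x\<^sub>n\<^sub>-\<^sub>1\<close> this
  renaming is injective on the letters, so the result is again reduced.
\<close>

definition shift_word :: "nat \<Rightarrow> nat \<Rightarrow> nat word \<Rightarrow> nat word" where
  "shift_word n i = map (\<lambda>(j, a). ((i + j) mod n, a))"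

definition cyclically_presented_group :: "nat \<Rightarrow> nat word \<Rightarrow> nat word set monoid" where
  "cyclically_presented_group n w =
     presented_group {..<n} ((\<lambda>i. shift_word n i w) ` {..<n})"

definition gen_prod :: "nat \<Rightarrow> nat list \<Rightarrow> nat word" where
  "gen_prod n js =
     foldr (\<lambda>j u. free_gen (j mod n) \<otimes>\<^bsub>free_group {..<n}\<^esub> u) js \<one>\<^bsub>free_group {..<n}\<^esub>"

definition fibonacci_word :: "nat \<Rightarrow> nat \<Rightarrow> nat \<Rightarrow> nat word" where
  "fibonacci_word r n s =
     gen_prod n [0..<r] \<otimes>\<^bsub>free_group {..<n}\<^esub> inv\<^bsub>free_group {..<n}\<^esub> gen_prod n [r..<r + s]"

definition gen_fibonacci_group :: "nat \<Rightarrow> nat \<Rightarrow> nat \<Rightarrow> nat word set monoid" where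
  "gen_fibonacci_group r n s = cyclically_presented_group n (fibonacci_word r n s)"

lemma reduced_tl: "reduced (l # u) \<Longrightarrow> reduced u"
  by (cases "l # u" rule: reduced.cases) auto

lemma reduced_cons_reduce: "reduced u \<Longrightarrow> reduced (cons_reduce l u)"
  by (cases "(l, u)" rule: cons_reduce.cases) (auto dest: reduced_tl)

lemma reduced_reduce: "reduced (reduce u)"
  by (induction u) (auto simp: reduce_def reduced_cons_reduce)

lemma reduce_reduced: "reduced u \<Longrightarrow> reduce u = u"
proof (induction u)
  case (Cons l u)
  then have "reduce (l # u) = cons_reduce l u"
    by (auto simp: reduce_def dest: reduced_tl)
  also have "\<dots> = l # u"
    using Cons.prems by (cases "(l, u)" rule: cons_reduce.cases) auto
  finally show ?case .
qed (simp add: reduce_def)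

lemma cons_reduce_cancel:
  assumes "reduced u" "a \<noteq> b"
  shows "cons_reduce (x, a) (cons_reduce (x, b) u) = u"
proof (cases u)
  case (Cons l v)
  obtain y c where l: "l = (y, c)" by force
  show ?thesis
  proof (cases "x = y \<and> b \<noteq> c")
    case True
    then have "a = c" using assms by auto
    with True assms Cons l show ?thesis
      by (cases v) (auto split: prod.splits)
  qed (use assms Cons l in auto)
qed (use assms in auto)

lemma foldr_cons_reduce: "reduced v \<Longrightarrow> foldr cons_reduce u v = reduce (u @ v)"
  using reduce_reduced[of v] by (simp add: reduce_def)

lemma foldr_cons_reduce_cons_reduce:
  assumes "reduced v"
  shows "foldr cons_reduce (cons_reduce l u) v = cons_reduce l (foldr cons_reduce u v)"
proof (cases "(l, u)" rule: cons_reduce.cases)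
  case (1 x a y b w)
  have "reduced (foldr cons_reduce w v)"
    using assms by (simp add: foldr_cons_reduce reduced_reduce)
  from cons_reduce_cancel[OF this] show ?thesis using 1 by simp
qed auto

lemma reduce_append_reduce:
  "reduce (reduce u @ v) = reduce (u @ v)" "reduce (u @ reduce v) = reduce (u @ v)"
proof -
  have "foldr cons_reduce (reduce u) w = foldr cons_reduce u w" if "reduced w" for w
    by (induction u) (use that in \<open>auto simp: reduce_def foldr_cons_reduce_cons_reduce\<close>)
  from this[OF reduced_reduce, of v] show "reduce (reduce u @ v) = reduce (u @ v)"
    by (simp add: reduce_def)
  show "reduce (u @ reduce v) = reduce (u @ v)"
    using reduce_reduced[OF reduced_reduce, of v] by (simp add: reduce_def)
qed

lemma reduce_in_lists: "u \<in> lists R \<Longrightarrow> reduce u \<in> lists R"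
proof (induction u)
  case (Cons l u)
  then show ?case
    by (cases "(l, reduce u)" rule: cons_reduce.cases) (auto simp: reduce_def)
qed (simp add: reduce_def)

definition inv_word :: "'a word \<Rightarrow> 'a word" where
  "inv_word u = rev (map (map_prod id Not) u)"

lemma reduce_inv_word: "reduce (inv_word u @ u) = []"
proof (induction u)
  case (Cons l u)
  obtain x a where l: "l = (x, a)" by force
  have "reduce (inv_word (l # u) @ l # u)
      = reduce (inv_word u @ reduce ([(x, \<not> a)] @ (x, a) # u))"
    by (simp add: l inv_word_def reduce_append_reduce(2))
  also have "reduce ([(x, \<not> a)] @ (x, a) # u) = reduce u"
    using cons_reduce_cancel[OF reduced_reduce, of "\<not> a" a x u] by (simp add: reduce_def)
  finally show ?case using Cons.IH by (simp add: reduce_append_reduce)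
qed (simp add: reduce_def inv_word_def)

lemma inv_word_in_lists: "u \<in> lists (A \<times> UNIV) \<Longrightarrow> inv_word u \<in> lists (A \<times> UNIV)"
  by (induction u) (auto simp: inv_word_def)

lemma reduce_in_free_group: "u \<in> lists (A \<times> UNIV) \<Longrightarrow> reduce u \<in> carrier (free_group A)"
  using reduce_in_lists by (auto simp: free_group_def reduced_reduce simp del: in_lists_conv_set)

lemma group_free_group: "group (free_group A)"
proof (rule groupI)
  fix u v assume "u \<in> carrier (free_group A)" "v \<in> carrier (free_group A)"
  then have "u @ v \<in> lists (A \<times> UNIV)" by (auto simp: free_group_def)
  from reduce_in_free_group[OF this]
  show "u \<otimes>\<^bsub>free_group A\<^esub> v \<in> carrier (free_group A)" by (simp add: free_group_def)
next
  show "\<one>\<^bsub>free_group A\<^esub> \<in> carrier (free_group A)" by (simp add: free_group_def)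
next
  fix u v w
  show "u \<otimes>\<^bsub>free_group A\<^esub> v \<otimes>\<^bsub>free_group A\<^esub> w
      = u \<otimes>\<^bsub>free_group A\<^esub> (v \<otimes>\<^bsub>free_group A\<^esub> w)"
    by (simp add: free_group_def reduce_append_reduce)
next
  fix u assume u: "u \<in> carrier (free_group A)"
  then show "\<one>\<^bsub>free_group A\<^esub> \<otimes>\<^bsub>free_group A\<^esub> u = u"
    by (simp add: free_group_def reduce_reduced)
  from u have "inv_word u \<in> lists (A \<times> UNIV)"
    by (intro inv_word_in_lists) (simp add: free_group_def)
  from reduce_in_free_group[OF this]
  show "\<exists>v\<in>carrier (free_group A). v \<otimes>\<^bsub>free_group A\<^esub> u = \<one>\<^bsub>free_group A\<^esub>"
    by (rule bexI[rotated]) (simp add: free_group_def reduce_append_reduce reduce_inv_word)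
qed

lemma (in group) normal_closure_normal:
  assumes "R \<subseteq> carrier G"
  shows "normal_closure G R \<lhd> G"
  unfolding normal_closure_def
proof (rule normal_generateI)
  fix h g assume "h \<in> {g \<otimes> a \<otimes> inv g |g a. g \<in> carrier G \<and> a \<in> R}" and g: "g \<in> carrier G"
  then obtain k a where h: "k \<in> carrier G" "a \<in> R" "h = k \<otimes> a \<otimes> inv k" by blast
  with assms g have "g \<otimes> h \<otimes> inv g = (g \<otimes> k) \<otimes> a \<otimes> inv (g \<otimes> k)"
    by (auto simp: inv_mult_group m_assoc subset_iff)
  with h g show "g \<otimes> h \<otimes> inv g \<in> {g \<otimes> a \<otimes> inv g |g a. g \<in> carrier G \<and> a \<in> R}"
    by blast
qed (use assms in auto)

lemma group_presented_group:
  "R \<subseteq> carrier (free_group A) \<Longrightarrow> group (presented_group A R)"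
  unfolding presented_group_def
  by (intro normal.factorgroup_is_group group.normal_closure_normal group_free_group)

lemma (in group) comm_group_abelianization: "comm_group (abelianization G)"
  unfolding abelianization_def
  by (rule derived_quot_is_comm_group)

lemma shift_word_carrier:
  assumes "w \<in> carrier (free_group {..<n})"
  shows "shift_word n i w \<in> carrier (free_group {..<n})"
proof -
  have inj: "j = k" if "(i + j) mod n = (i + k) mod n" "j < n" "k < n" for j k
  proof -
    from that(1) have "int (i + j) mod int n = int (i + k) mod int n"
      by (metis zmod_int)
    then have "int n dvd int j - int k" by (simp add: mod_eq_dvd_iff)
    with that(2,3) show ?thesis
      using dvd_imp_le_int[of "int j - int k" "int n"] by linarith
  qed
  have "reduced w \<Longrightarrow> w \<in> lists ({..<n} \<times> UNIV) \<Longrightarrow> reduced (shift_word n i w)"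
    by (induction w rule: reduced.induct) (auto simp: shift_word_def dest: inj)
  moreover have "w \<in> lists ({..<n} \<times> UNIV) \<Longrightarrow> shift_word n i w \<in> lists ({..<n} \<times> UNIV)"
    by (induction w) (auto simp: shift_word_def)
  ultimately show ?thesis
    using assms by (auto simp: free_group_def)
qed

lemma fibonacci_word_carrier:
  assumes "n > 0"
  shows "fibonacci_word r n s \<in> carrier (free_group {..<n})"
proof -
  interpret group "free_group {..<n}" by (rule group_free_group)
  have gen: "free_gen (j mod n) \<in> carrier (free_group {..<n})" for j
    using assms by (auto simp: free_gen_def free_group_def)
  have "gen_prod n js \<in> carrier (free_group {..<n})" for js
    by (induction js) (auto simp: gen_prod_def gen)
  then show ?thesis by (simp add: fibonacci_word_def)
qed

lemma group_gen_fibonacci_group: "n > 0 \<Longrightarrow> group (gen_fibonacci_group r n s)"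
  unfolding gen_fibonacci_group_def cyclically_presented_group_def
  by (intro group_presented_group) (auto intro!: shift_word_carrier fibonacci_word_carrier)

end

theory Submission
  imports Defs "HOL-Computational_Algebra.Polynomial"
begin

text \<open>
  The abelianization of \<open>G\<^sub>n(w)\<close> is \<open>\<int>[t]/(t\<^sup>n - 1, f)\<close>, where \<open>f\<close> is the sum of the exponents of \<open>w\<close>
  weighted by \<open>x\<^sub>j \<mapsto> t\<^sup>j\<close>. For \<open>\<H>(r,n,s)\<close> with \<open>d = gcd(r,n,s)\<close> this polynomial is
  \<open>f = (1 + t + \<dots> + t\<^sup>d\<^sup>-\<^sup>1) F(t\<^sup>d)\<close>, where \<open>F\<close> belongs to \<open>\<H>(R,N,S)\<close>, and \<open>F(1) = R - S = -1\<close>.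
  Write \<open>p = \<Sum>\<^sub>j\<^sub><\<^sub>d t\<^sup>j p\<^sub>j(t\<^sup>d)\<close> and map \<open>p\<close> to the classes of the \<open>p\<^sub>j\<close> modulo \<open>(u\<^sup>N - 1, F(u))\<close>, together
  with the integers \<open>p\<^sub>j(1) - p\<^sub>d\<^sub>-\<^sub>1(1)\<close> for \<open>j < d - 1\<close>. Since \<open>F(1) = -1\<close>, the values at \<open>1\<close> can be
  prescribed independently of the classes, so this map is surjective. Its kernel is \<open>(t\<^sup>n - 1, f)\<close>: if all
  \<open>p\<^sub>j = b\<^sub>j F\<close> have the same value \<open>-b\<^sub>j(1) = c\<close> at \<open>1\<close>, then \<open>b\<^sub>j \<equiv> -c\<close> modulo \<open>u - 1\<close>, and \<open>t\<^sup>d - 1\<close> is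
  divisible by \<open>1 + t + \<dots> + t\<^sup>d\<^sup>-\<^sup>1\<close>.
\<close>

section \<open>The additive group of integer polynomials\<close>

definition poly_group :: "int poly monoid" where
  "poly_group = \<lparr>carrier = UNIV, monoid.mult = (+), one = 0\<rparr>"

lemma poly_group_simps [simp]:
  "carrier poly_group = UNIV" "p \<otimes>\<^bsub>poly_group\<^esub> q = p + q" "\<one>\<^bsub>poly_group\<^esub> = 0"
  by (simp_all add: poly_group_def)

lemma comm_group_poly_group: "comm_group poly_group"
  by (rule comm_groupI) (auto simp: algebra_simps intro: exI[of _ "- x" for x])

lemma group_poly_group [simp]: "group poly_group"
  using comm_group_poly_group by (simp add: comm_group_def)

lemma inv_poly_group [simp]: "inv\<^bsub>poly_group\<^esub> p = - p"
  by (rule group.inv_equality) auto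

lemma int_pow_poly_group: "p [^]\<^bsub>poly_group\<^esub> (c::int) = smult c p"
proof -
  have nat: "p [^]\<^bsub>poly_group\<^esub> (k::nat) = smult (int k) p" for k
    by (induction k) (simp_all add: smult_add_left add.commute)
  show ?thesis by (simp add: int_pow_def2 nat flip: smult_minus_left)
qed

text \<open>The monomials \<open>monom 1 k\<close> generate the group: \<open>monom c k\<close> is
  the \<open>c\<close>-th power of \<open>monom 1 k\<close>, and every polynomial is a finite sum of
  such terms.\<close>

lemma hom_poly_group_eqI:
  assumes "group H" "h \<in> hom poly_group H" "g \<in> hom poly_group H"
    and "\<And>k. h (monom 1 k) = g (monom 1 k)"
  shows "h p = g p"
proof -
  interpret h: group_hom poly_group H h
    using assms by (simp add: group_hom_def group_hom_axioms_def)
  interpret g: group_hom poly_group H g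
    using assms by (simp add: group_hom_def group_hom_axioms_def)
  have monom: "h (monom c k) = g (monom c k)" for c k
    using h.hom_int_pow[of "monom 1 k" c] g.hom_int_pow[of "monom 1 k" c] assms(4)
    by (simp add: int_pow_poly_group smult_monom)
  have "h (\<Sum>i\<in>S. monom (c i) i) = g (\<Sum>i\<in>S. monom (c i) i)" if "finite S" for S c
    using that
  proof (induction S)
    case empty
    then show ?case using h.hom_one g.hom_one by simp
  next
    case (insert i S)
    then show ?case
      using h.hom_mult[of "monom (c i) i" "\<Sum>i\<in>S. monom (c i) i"]
        g.hom_mult[of "monom (c i) i" "\<Sum>i\<in>S. monom (c i) i"] monom by simp
  qed
  from this[of "{..degree p}" "coeff p"] show ?thesis
    by (simp add: poly_as_sum_of_monoms)
qed

text \<open>The group is free abelian on the powers of t; together with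
  \<open>hom_poly_group_eqI\<close> this lets homomorphisms be defined and compared on
  monomials.\<close>

lemma hom_poly_group_exists:
  assumes "comm_group H" "\<And>k. x k \<in> carrier H"
  obtains h where "h \<in> hom poly_group H" "\<And>k. h (monom 1 k) = x k"
proof -
  interpret comm_group H by fact
  define h where "h (p :: int poly) = (\<Otimes>\<^bsub>H\<^esub>k\<in>{..degree p}. x k [^]\<^bsub>H\<^esub> coeff p k)" for p
  \<comment> \<open>Extending the product past the degree adds only trivial factors, so
    \<open>p\<close>, \<open>q\<close> and \<open>p + q\<close> can share one index range.\<close>
  have h_eq: "h p = (\<Otimes>\<^bsub>H\<^esub>k\<in>{..m}. x k [^]\<^bsub>H\<^esub> coeff p k)" if "degree p \<le> m" for p :: "int poly" and m
    unfolding h_def by (rule finprod_mono_neutral_cong_left)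
      (use that assms(2) in \<open>auto simp: coeff_eq_0\<close>)
  show ?thesis
  proof
    show "h \<in> hom poly_group H"
    proof (rule homI)
      show "h p \<in> carrier H" for p
        unfolding h_def by (rule finprod_closed) (use assms(2) in auto)
      fix p q :: "int poly"
      define m where "m = max (degree p) (degree q)"
      have "degree p \<le> m" "degree q \<le> m" "degree (p + q) \<le> m"
        by (simp_all add: m_def degree_add_le_max)
      then show "h (p \<otimes>\<^bsub>poly_group\<^esub> q) = h p \<otimes>\<^bsub>H\<^esub> h q"
        using assms(2)
        by (simp add: h_eq[of _ m] int_pow_mult finprod_multf[symmetric] Pi_def del: finprod_multf)
    qed
    show "h (monom 1 k) = x k" for k
    proof -
      have "h (monom 1 k) = (\<Otimes>\<^bsub>H\<^esub>j\<in>{..k}. if k = j then x j else \<one>\<^bsub>H\<^esub>)"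
        unfolding h_eq[OF degree_monom_le] using assms(2)
        by (intro finprod_cong) (auto simp: simp_implies_def)
      also have "\<dots> = x k"
        using assms(2) by (intro finprod_singleton) auto
      finally show ?thesis .
    qed
  qed
qed

section \<open>Splitting a polynomial by residues of exponents\<close>

text \<open>\<open>section_poly d j p\<close> is the \<open>p\<^sub>j\<close> in \<open>p(t) = \<Sum>\<^sub>j\<^sub><\<^sub>d t\<^sup>j p\<^sub>j(t\<^sup>d)\<close>.\<close>

definition section_poly :: "nat \<Rightarrow> nat \<Rightarrow> int poly \<Rightarrow> int poly" where
  "section_poly d j p = Poly (map (\<lambda>k. coeff p (k * d + j)) [0..<Suc (degree p)])"

lemma coeff_section_poly:
  assumes "d > 0"
  shows "coeff (section_poly d j p) k = coeff p (k * d + j)"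
proof (cases "k \<le> degree p")
  case True
  then show ?thesis by (simp add: section_poly_def nth_default_def del: upt_Suc)
next
  case False
  \<comment> \<open>The list defining \<open>section_poly\<close> stops at
    \<open>k = degree p\<close>; beyond that, the index \<open>k * d + j\<close> exceeds the degree
    as well.\<close>
  moreover from assms have "k \<le> k * d" by simp
  ultimately have "degree p < k * d + j" by linarith
  with False show ?thesis
    by (simp add: section_poly_def nth_default_def coeff_eq_0 del: upt_Suc)
qed

lemma pcompose_monom: "monom 1 k \<circ>\<^sub>p q = (q :: int poly) ^ k"
  by (induction k) (simp_all add: monom_Suc pcompose_pCons monom_0 pcompose_1)

context
  fixes d :: nat
  assumes d_pos: "d > 0"
begin

lemma section_poly_add: "section_poly d j (p + q) = section_poly d j p + section_poly d j q"
  by (simp add: poly_eq_iff coeff_section_poly d_pos)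

lemma section_poly_diff: "section_poly d j (p - q) = section_poly d j p - section_poly d j q"
  by (simp add: poly_eq_iff coeff_section_poly d_pos)

lemma section_poly_smult: "section_poly d j (smult c p) = smult c (section_poly d j p)"
  by (simp add: poly_eq_iff coeff_section_poly d_pos)

text \<open>Multiplication by t rotates the sections; the passage from the last residue class to
  class 0 completes a power t^d and leaves a factor of the new variable.\<close>

lemma section_poly_pCons_0: "section_poly d 0 (pCons 0 p) = pCons 0 (section_poly d (d - 1) p)"
proof (rule poly_eqI)
  fix k
  show "coeff (section_poly d 0 (pCons 0 p)) k = coeff (pCons 0 (section_poly d (d - 1) p)) k"
  proof (cases k)
    case (Suc l)
    with d_pos have "k * d + 0 = Suc (l * d + (d - 1))" by simp
    with Suc show ?thesis by (simp only: coeff_section_poly d_pos coeff_pCons_Suc)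
  qed (simp add: coeff_section_poly d_pos)
qed

lemma section_poly_pCons_Suc: "section_poly d (Suc j) (pCons 0 p) = section_poly d j p"
  by (simp add: poly_eq_iff coeff_section_poly d_pos)

lemma section_poly_monom:
  assumes "j < d"
  shows "section_poly d j (monom c m) = (if m mod d = j then monom c (m div d) else 0)"
proof -
  have "k * d + j = m \<longleftrightarrow> m mod d = j \<and> m div d = k" for k
    using assms by auto
  then show ?thesis by (auto simp: poly_eq_iff coeff_section_poly d_pos)
qed

text \<open>Both sides are additive in \<open>p\<close>, and for \<open>monom 1 m\<close> only the
  summand \<open>j = m mod d\<close> survives.\<close>

lemma section_poly_decomp:
  fixes p :: "int poly"
  shows "p = (\<Sum>j<d. monom 1 j * (section_poly d j p \<circ>\<^sub>p monom 1 d))"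
proof -
  define g where "g p = (\<Sum>j<d. monom 1 j * (section_poly d j p \<circ>\<^sub>p monom 1 d))" for p
  have "id p = g p"
  proof (rule hom_poly_group_eqI[where H = poly_group and h = id and g = g])
    fix m
    have "(\<Sum>j<d. monom 1 j * (section_poly d j (monom 1 m) \<circ>\<^sub>p monom 1 d))
        = (\<Sum>j<d. if m mod d = j then monom 1 j * monom 1 (d * (m div d)) else 0)"
      by (rule sum.cong)
        (auto simp: section_poly_monom pcompose_monom monom_power mult.commute)
    also have "\<dots> = monom 1 m"
      using d_pos by (simp add: mult_monom)
    finally show "id (monom 1 m) = g (monom 1 m)" by (simp add: g_def)
  qed (auto simp: g_def hom_def section_poly_add pcompose_add algebra_simps sum.distrib)
  then show ?thesis by (simp add: g_def)
qed

lemma section_poly_surj: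
  obtains p where "\<And>j. j < d \<Longrightarrow> section_poly d j p = P j"
proof -
  \<comment> \<open>A common degree bound: no nonzero prescribed coefficient lies at or beyond index
    \<open>Suc m * d\<close>.\<close>
  define m where "m = Max ((\<lambda>j. degree (P j)) ` {..<d})"
  define p where "p = Poly (map (\<lambda>i. coeff (P (i mod d)) (i div d)) [0..<Suc m * d])"
  have "coeff p i = coeff (P (i mod d)) (i div d)" for i
  proof (cases "i < Suc m * d")
    case False
    then have "Suc m \<le> i div d"
      using d_pos by (simp add: less_eq_div_iff_mult_less_eq)
    moreover have "degree (P (i mod d)) \<le> m"
      unfolding m_def using d_pos by (intro Max_ge) auto
    ultimately show ?thesis
      using False by (simp add: p_def nth_default_def coeff_eq_0)
  qed (simp add: p_def nth_default_def)
  then have "section_poly d j p = P j" if "j < d" for j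
    using that by (auto simp: poly_eq_iff coeff_section_poly d_pos)
  then show thesis by (rule that)
qed

end

section \<open>Ideals containing \<open>t\<^sup>n - 1\<close>\<close>

definition cyc_ideal :: "nat \<Rightarrow> int poly \<Rightarrow> int poly set" where
  "cyc_ideal n f = {a * (monom 1 n - 1) + b * f | a b. True}"

lemma cyc_ideal_mult: "p \<in> cyc_ideal n f \<Longrightarrow> q * p \<in> cyc_ideal n f"
proof -
  assume "p \<in> cyc_ideal n f"
  then obtain a b where "p = a * (monom 1 n - 1) + b * f" by (auto simp: cyc_ideal_def)
  then have "q * p = (q * a) * (monom 1 n - 1) + (q * b) * f" by (simp only: distrib_left mult.assoc)
  then show ?thesis unfolding cyc_ideal_def by blast
qed

lemma cyc_ideal_add: "p \<in> cyc_ideal n f \<Longrightarrow> q \<in> cyc_ideal n f \<Longrightarrow> p + q \<in> cyc_ideal n f"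
proof -
  assume "p \<in> cyc_ideal n f" "q \<in> cyc_ideal n f"
  then obtain a b a' b' where
    "p = a * (monom 1 n - 1) + b * f" "q = a' * (monom 1 n - 1) + b' * f"
    by (auto simp: cyc_ideal_def)
  then have "p + q = (a + a') * (monom 1 n - 1) + (b + b') * f" by (simp add: algebra_simps)
  then show ?thesis unfolding cyc_ideal_def by blast
qed

lemma gens_in_cyc_ideal: "f \<in> cyc_ideal n f" "monom 1 n - 1 \<in> cyc_ideal n f" "0 \<in> cyc_ideal n f"
proof -
  have "f = 0 * (monom 1 n - 1) + 1 * f" "monom 1 n - 1 = 1 * (monom 1 n - 1) + 0 * f"
    "0 = 0 * (monom 1 n - 1) + 0 * f" by simp_all
  then show "f \<in> cyc_ideal n f" "monom 1 n - 1 \<in> cyc_ideal n f" "0 \<in> cyc_ideal n f"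
    unfolding cyc_ideal_def by blast+
qed

lemma subgroup_cyc_ideal: "subgroup (cyc_ideal n f) poly_group"
  using cyc_ideal_mult[of _ n f "- 1"]
  by unfold_locales (auto simp: cyc_ideal_add gens_in_cyc_ideal)

text \<open>A multiple of t^n - 1 can be absorbed by the other generator. This permits unreduced
  exponents in \<open>fib_poly\<close>, whereas words carry subscripts mod \<open>n\<close>.\<close>

lemma cyc_ideal_cong:
  assumes "monom 1 n - 1 dvd f - g"
  shows "cyc_ideal n f = cyc_ideal n g"
proof -
  have "cyc_ideal n f \<subseteq> cyc_ideal n g" if "monom 1 n - 1 dvd f - g" for f g
  proof
    from that obtain c where "f = g + (monom 1 n - 1) * c"
      by (metis add.commute diff_add_cancel dvdE)
    then have "f \<in> cyc_ideal n g"
      using cyc_ideal_add[OF gens_in_cyc_ideal(1) cyc_ideal_mult[OF gens_in_cyc_ideal(2)]]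
      by (metis mult.commute)
    then show "p \<in> cyc_ideal n g" if "p \<in> cyc_ideal n f" for p
      using that by (auto simp: cyc_ideal_def[of n f] intro!: cyc_ideal_add cyc_ideal_mult
          gens_in_cyc_ideal(2))
  qed
  from this[OF assms] this[of g f] assms show ?thesis
    by (metis dvd_minus_iff minus_diff_eq subset_antisym)
qed

text \<open>Forward, the condition on the sections is stable under addition and multiplication, so
  checking the generators suffices. Backward, the common value \<open>c\<close> makes the cofactors
  of \<open>F\<close> agree modulo u - 1, and for u = t^d the multiples of (u - 1) F(u) are
  multiples of \<open>f\<close>.\<close>

lemma cyc_ideal_sections_iff:
  assumes d: "d > 0" and f: "\<And>j. j < d \<Longrightarrow> section_poly d j f = F"
    and F1: "poly F 1 = -1"
  shows "p \<in> cyc_ideal (N * d) f \<longleftrightarrow>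
    (\<exists>c. \<forall>j<d. section_poly d j p \<in> cyc_ideal N F \<and> poly (section_poly d j p) 1 = c)"
    (is "_ \<longleftrightarrow> ?K p")
proof
  note dl = section_poly_add[OF d] section_poly_smult[OF d]
  define K where "K q \<longleftrightarrow>
    (\<exists>c. \<forall>j<d. section_poly d j q \<in> cyc_ideal N F \<and> poly (section_poly d j q) 1 = c)" for q
  have K_add: "K (p + q)" if "K p" "K q" for p q
    using that unfolding K_def dl by (metis cyc_ideal_add poly_add)
  have K_smult: "K (smult c p)" if "K p" for c p
    using that cyc_ideal_mult[of _ N F "[:c:]"] unfolding K_def dl by fastforce
  \<comment> \<open>Rotating the sections is harmless because \<open>c\<close> is the same for all
    \<open>j\<close>, and the extra factor u has value 1 at 1.\<close>
  have K_shift: "K (pCons 0 p)" if "K p" for p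
  proof -
    from that obtain c where c:
      "\<And>j. j < d \<Longrightarrow> section_poly d j p \<in> cyc_ideal N F \<and> poly (section_poly d j p) 1 = c"
      unfolding K_def by blast
    have "section_poly d j (pCons 0 p) \<in> cyc_ideal N F \<and> poly (section_poly d j (pCons 0 p)) 1 = c"
      if "j < d" for j
    proof (cases j)
      case 0
      then show ?thesis
        using cyc_ideal_mult[of "section_poly d (d - 1) p" N F "[:0, 1:]"] c[of "d - 1"] d
        by (simp add: section_poly_pCons_0[OF d])
    next
      case (Suc i)
      then show ?thesis using c[of i] that by (simp add: section_poly_pCons_Suc[OF d])
    qed
    then show ?thesis unfolding K_def by blast
  qed
  have K_mult: "K (a * p)" if "K p" for a p
  proof (induction a)
    case 0
    from K_smult[OF that, of 0] show ?case by simp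
  next
    case (pCons c a)
    then show ?case
      using K_add[OF K_smult[OF that] K_shift, of "a * p" c] by (simp add: mult_pCons_left)
  qed
  have "K f"
    using d f by (simp add: K_def gens_in_cyc_ideal)
  moreover have "K (monom 1 (N * d) - 1)"
  proof -
    \<comment> \<open>Both exponents \<open>N * d\<close> and 0 lie in residue class 0. All sections
      vanish at 1, so here \<open>c = 0\<close>.\<close>
    have "section_poly d j (monom 1 (N * d) - 1) = (if j = 0 then monom 1 N - 1 else 0)"
      if "j < d" for j
      using section_poly_diff[OF d, of j "monom 1 (N * d)" "monom 1 0"]
      unfolding section_poly_monom[OF d that] using that d by simp
    with d show ?thesis by (auto simp: K_def gens_in_cyc_ideal poly_monom)
  qed
  ultimately have "K p" if "p \<in> cyc_ideal (N * d) f"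
  proof -
    from that obtain a b where p: "p = a * (monom 1 (N * d) - 1) + b * f"
      unfolding cyc_ideal_def by blast
    show ?thesis
      unfolding p by (rule K_add; rule K_mult; fact)
  qed
  then show "?K p" if "p \<in> cyc_ideal (N * d) f"
    using that by (simp add: K_def)
next
  assume "?K p"
  then obtain c where K: "\<And>j. j < d \<Longrightarrow> section_poly d j p \<in> cyc_ideal N F"
    and c: "\<And>j. j < d \<Longrightarrow> poly (section_poly d j p) 1 = c"
    by blast
  define u :: "int poly" where "u = monom 1 d"
  have f_eq: "f = (\<Sum>j<d. monom 1 j) * (F \<circ>\<^sub>p u)"
    using section_poly_decomp[OF d, of f] f by (simp add: u_def sum_distrib_right)
  \<comment> \<open>The geometric sum is also the cofactor of F(u) in \<open>f\<close>; hence (u -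
    1) F(u) equals (t - 1) f.\<close>
  have geom: "u - 1 = (monom 1 1 - 1) * (\<Sum>j<d. monom 1 j)"
    using power_diff_1_eq[of "monom 1 1 :: int poly" d]
    by (simp add: u_def monom_power flip: lessThan_atLeast0)
  have geom_f: "(u - 1) * (F \<circ>\<^sub>p u) = (monom 1 1 - 1) * f"
    by (simp only: geom f_eq mult.assoc)
  \<comment> \<open>Evaluation at 1 kills u^N - 1, and F(1) = -1, so the cofactor \<open>B\<close>
    of \<open>F\<close> has B(1) = -c and \<open>B + [:c:]\<close> is divisible by u - 1.\<close>
  have "\<exists>A C. section_poly d j p = A * (monom 1 N - 1) + ([:-c:] + [:-1, 1:] * C) * F"
    if "j < d" for j
  proof -
    from K[OF that] obtain A B where AB: "section_poly d j p = A * (monom 1 N - 1) + B * F"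
      unfolding cyc_ideal_def by blast
    have "poly (section_poly d j p) 1 = c" using that by (rule c)
    with F1 have "poly (B + [:c:]) 1 = 0" by (simp add: AB poly_monom)
    then obtain C where "B + [:c:] = [:-1, 1:] * C"
      using poly_eq_0_iff_dvd by (metis dvdE)
    moreover have "[:-c:] = - [:c:]" by simp
    ultimately have "B = [:-c:] + [:-1, 1:] * C"
      by (metis add.commute add_diff_cancel_right' diff_conv_add_uminus)
    with AB show ?thesis by blast
  qed
  then obtain A C where AC: "section_poly d j p
      = A j * (monom 1 N - 1) + ([:-c:] + [:-1, 1:] * C j) * F" if "j < d" for j
    by metis
  have uN: "(monom 1 N - 1) \<circ>\<^sub>p u = monom 1 (N * d) - 1"
    by (simp add: pcompose_diff pcompose_monom pcompose_1 u_def monom_power mult.commute)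
  have lin: "[:-1, 1:] \<circ>\<^sub>p u = u - 1"
    by (simp add: pcompose_pCons one_pCons)
  have "p = (\<Sum>j<d. monom 1 j * (section_poly d j p \<circ>\<^sub>p u))"
    using section_poly_decomp[OF d, of p] by (simp add: u_def)
  \<comment> \<open>The terms with \<open>[:-c:]\<close> add up to \<open>[:-c:] * f\<close> because
    \<open>c\<close> does not depend on \<open>j\<close>.\<close>
  also have "\<dots> = (\<Sum>j<d. (monom 1 j * (A j \<circ>\<^sub>p u)) * (monom 1 (N * d) - 1)
      + [:-c:] * (monom 1 j * (F \<circ>\<^sub>p u)) + (monom 1 j * (C j \<circ>\<^sub>p u)) * ((u - 1) * (F \<circ>\<^sub>p u)))"
    by (rule sum.cong[OF refl], subst AC, simp)
      (simp only: pcompose_add pcompose_mult uN lin pcompose_const, simp only: algebra_simps)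
  also have "\<dots> = (\<Sum>j<d. monom 1 j * (A j \<circ>\<^sub>p u)) * (monom 1 (N * d) - 1)
      + [:-c:] * f + (\<Sum>j<d. monom 1 j * (C j \<circ>\<^sub>p u)) * ((monom 1 1 - 1) * f)"
    by (simp only: sum.distrib sum_distrib_left[symmetric] sum_distrib_right[symmetric]
        geom_f f_eq[symmetric])
  also have "\<dots> \<in> cyc_ideal (N * d) f"
    by (intro cyc_ideal_add cyc_ideal_mult gens_in_cyc_ideal)
  finally show "p \<in> cyc_ideal (N * d) f" .
qed

section \<open>Abelianizations of presented groups\<close>

lemma (in group_hom) normal_closure_subset_kernel:
  assumes "R \<subseteq> kernel G H h"
  shows "normal_closure G R \<subseteq> kernel G H h"
  unfolding normal_closure_def
proof (rule G.generate_subgroup_incl[OF _ subgroup_kernel])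
  show "{g \<otimes> a \<otimes> inv g |g a. g \<in> carrier G \<and> a \<in> R} \<subseteq> kernel G H h"
    using assms by (auto simp: kernel_def subset_iff)
qed

lemma (in group_hom) derived_subset_kernel:
  assumes "comm_group H"
  shows "derived G (carrier G) \<subseteq> kernel G H h"
proof -
  interpret H: comm_group H by fact
  show ?thesis
    unfolding derived_def
  proof (rule G.generate_subgroup_incl[OF _ subgroup_kernel], rule subsetI)
    fix x assume "x \<in> derived_set G (carrier G)"
    then obtain a b where ab: "a \<in> carrier G" "b \<in> carrier G" "x = a \<otimes> b \<otimes> inv a \<otimes> inv b"
      by blast
    then have "h x = h b \<otimes>\<^bsub>H\<^esub> h a \<otimes>\<^bsub>H\<^esub> inv\<^bsub>H\<^esub> h a \<otimes>\<^bsub>H\<^esub> inv\<^bsub>H\<^esub> h b"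
      by (simp add: H.m_comm)
    with ab show "x \<in> kernel G H h"
      by (simp add: kernel_def H.m_assoc)
  qed
qed

definition ab_class :: "'a set \<Rightarrow> 'a word set \<Rightarrow> 'a word \<Rightarrow> 'a word set set" where
  "ab_class A R u = derived (presented_group A R) (carrier (presented_group A R))
     #>\<^bsub>presented_group A R\<^esub> (normal_closure (free_group A) R #>\<^bsub>free_group A\<^esub> u)"

context
  fixes A :: "'a set" and R :: "'a word set"
  assumes R: "R \<subseteq> carrier (free_group A)"
begin

lemma ab_class_hom: "ab_class A R \<in> hom (free_group A) (abelianization (presented_group A R))"
proof -
  interpret F: group "free_group A" by (rule group_free_group)
  interpret P: group "presented_group A R" by (rule group_presented_group[OF R])
  have "(\<lambda>u. normal_closure (free_group A) R #>\<^bsub>free_group A\<^esub> u)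
      \<in> hom (free_group A) (presented_group A R)"
    unfolding presented_group_def by (rule normal.r_coset_hom_Mod[OF F.normal_closure_normal[OF R]])
  moreover note normal.r_coset_hom_Mod[OF P.derived_self_is_normal]
  ultimately show ?thesis
    unfolding ab_class_def abelianization_def by (metis (no_types, lifting) hom_compose comp_def ext)
qed

lemma ab_class_surj:
  "ab_class A R ` carrier (free_group A) = carrier (abelianization (presented_group A R))"
  unfolding ab_class_def abelianization_def carrier_FactGroup
  by (simp add: presented_group_def carrier_FactGroup image_image)

lemma ab_class_relator:
  assumes "u \<in> R"
  shows "ab_class A R u = \<one>\<^bsub>abelianization (presented_group A R)\<^esub>"
proof -
  interpret F: group "free_group A" by (rule group_free_group)
  interpret N: normal "normal_closure (free_group A) R" "free_group A"
    by (rule F.normal_closure_normal[OF R])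
  interpret P: group "presented_group A R" by (rule group_presented_group[OF R])
  from assms R have u: "u \<in> carrier (free_group A)" by blast
  then have "u = \<one>\<^bsub>free_group A\<^esub> \<otimes>\<^bsub>free_group A\<^esub> u \<otimes>\<^bsub>free_group A\<^esub> inv\<^bsub>free_group A\<^esub> \<one>\<^bsub>free_group A\<^esub>"
    by simp
  with assms have "u \<in> normal_closure (free_group A) R"
    unfolding normal_closure_def by (intro generate.incl) blast
  then have "normal_closure (free_group A) R #>\<^bsub>free_group A\<^esub> u = \<one>\<^bsub>presented_group A R\<^esub>"
    using F.coset_join2[OF u N.subgroup_axioms] by (simp add: presented_group_def)
  then show ?thesis
    using P.coset_join2[OF P.one_closed P.derived_is_subgroup subgroup.one_closed[OF P.derived_is_subgroup]]
    by (simp add: ab_class_def abelianization_def)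
qed

text \<open>The universal property of quotients applies twice: first to the normal closure of the
  relators, then to the derived subgroup, which dies in any commutative group.\<close>

lemma abelianization_lift:
  assumes "comm_group K" "h \<in> hom (free_group A) K" "\<And>u. u \<in> R \<Longrightarrow> h u = \<one>\<^bsub>K\<^esub>"
  obtains g where "g \<in> hom (abelianization (presented_group A R)) K"
    "\<And>u. u \<in> carrier (free_group A) \<Longrightarrow> g (ab_class A R u) = h u"
proof -
  interpret F: group "free_group A" by (rule group_free_group)
  interpret K: comm_group K by fact
  interpret h: group_hom "free_group A" K h
    using assms(2) by unfold_locales
  have "R \<subseteq> kernel (free_group A) K h"
    using R assms(3) by (auto simp: kernel_def)
  then obtain g where g: "g \<in> hom (presented_group A R) K"
    "\<And>u. u \<in> carrier (free_group A) \<Longrightarrow> g (normal_closure (free_group A) R #>\<^bsub>free_group A\<^esub> u) = h u"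
    using h.FactGroup_universal_kernel[OF F.normal_closure_normal[OF R] h.normal_closure_subset_kernel]
    unfolding presented_group_def by blast
  interpret P: group "presented_group A R" by (rule group_presented_group[OF R])
  interpret g: group_hom "presented_group A R" K g
    using g(1) by unfold_locales
  obtain g' where g': "g' \<in> hom (abelianization (presented_group A R)) K"
    "\<And>x. x \<in> carrier (presented_group A R) \<Longrightarrow>
      g' (derived (presented_group A R) (carrier (presented_group A R)) #>\<^bsub>presented_group A R\<^esub> x) = g x"
    using g.FactGroup_universal_kernel[OF P.derived_self_is_normal g.derived_subset_kernel[OF assms(1)]]
    unfolding abelianization_def by blast
  have "g' (ab_class A R u) = h u" if "u \<in> carrier (free_group A)" for u
    using that g(2) g'(2) unfolding ab_class_def
    by (simp add: presented_group_def carrier_FactGroup)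
  with g'(1) show thesis by (rule that)
qed

end

section \<open>Exponent polynomials of words and the abelianization of a cyclically presented
  group\<close>

fun letter_poly :: "nat \<times> bool \<Rightarrow> int poly" where
  "letter_poly (j, a) = (if a then monom 1 j else - monom 1 j)"

text \<open>The coefficient of t^j is the exponent sum of x_j. Polynomials are used because a cyclic
  shift of subscripts becomes multiplication by a power of t modulo t^n - 1.\<close>

definition word_poly :: "nat word \<Rightarrow> int poly" where
  "word_poly u = sum_list (map letter_poly u)"

lemma word_poly_simps [simp]:
  "word_poly [] = 0" "word_poly (l # u) = letter_poly l + word_poly u"
  "word_poly (u @ v) = word_poly u + word_poly v"
  by (simp_all add: word_poly_def)

lemma word_poly_reduce: "word_poly (reduce u) = word_poly u"
proof (induction u)
  case (Cons l u)
  have "word_poly (cons_reduce l v) = letter_poly l + word_poly v" for v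
    by (cases "(l, v)" rule: cons_reduce.cases) auto
  with Cons show ?case by (simp add: reduce_def)
qed (simp add: reduce_def)

lemma word_poly_hom: "word_poly \<in> hom (free_group A) poly_group"
  by (rule homI) (simp_all add: free_group_def word_poly_reduce)

lemma hom_free_group_eqI:
  assumes "group H" "h \<in> hom (free_group A) H" "g \<in> hom (free_group A) H"
    and "\<And>x. x \<in> A \<Longrightarrow> h (free_gen x) = g (free_gen x)" "u \<in> carrier (free_group A)"
  shows "h u = g u"
proof -
  interpret F: group "free_group A" by (rule group_free_group)
  interpret h: group_hom "free_group A" H h
    using assms by (simp add: group_hom_def group_hom_axioms_def group_free_group)
  interpret g: group_hom "free_group A" H g
    using assms by (simp add: group_hom_def group_hom_axioms_def group_free_group)
  show ?thesis
    using assms(5)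
  proof (induction u)
    case Nil
    show ?case using h.hom_one g.hom_one by (simp add: free_group_def)
  next
    case (Cons l u)
    obtain x a where l: "l = (x, a)" by force
    with Cons.prems have x: "x \<in> A" and u: "u \<in> carrier (free_group A)" and red: "reduced (l # u)"
      by (auto simp: free_group_def dest: reduced_tl)
    have gen: "free_gen x \<in> carrier (free_group A)" and lc: "[l] \<in> carrier (free_group A)"
      using x by (simp_all add: free_gen_def free_group_def l)
    have "[(x, False)] = inv\<^bsub>free_group A\<^esub> free_gen x"
      using x by (intro F.inv_equality[symmetric])
        (auto simp: free_gen_def free_group_def reduce_def)
    then have "h [l] = g [l]"
      using assms(4)[OF x] gen by (cases a) (simp_all add: l free_gen_def)
    \<comment> \<open>The word \<open>l # u\<close> is reduced, so this product involves no
      cancellation.\<close>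
    moreover have "l # u = [l] \<otimes>\<^bsub>free_group A\<^esub> u"
      using red by (simp add: free_group_def reduce_reduced)
    ultimately show ?case
      using h.hom_mult[OF lc u] g.hom_mult[OF lc u] Cons.IH[OF u] by simp
  qed
qed

lemma monom_mod_dvd: "monom 1 n - 1 dvd (monom 1 (k mod n) - monom 1 k :: int poly)"
proof -
  have "(monom 1 k :: int poly) = monom 1 (k mod n) * monom 1 n ^ (k div n)"
    by (simp add: monom_power mult_monom)
  then have "(monom 1 (k mod n) - monom 1 k :: int poly)
      = monom 1 (k mod n) * - (monom 1 n ^ (k div n) - 1)"
    by (simp add: algebra_simps)
  moreover have "monom 1 n - 1 dvd (monom 1 n ^ (k div n) - 1 :: int poly)"
    by (simp add: power_diff_1_eq)
  ultimately show ?thesis by (metis dvd_minus_iff dvd_mult)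
qed

text \<open>Each letter contributes separately, and reducing its subscript mod \<open>n\<close>
  changes its monomial by a multiple of t^n - 1.\<close>

lemma word_poly_shift_dvd:
  "monom 1 n - 1 dvd word_poly (shift_word n i u) - monom 1 i * word_poly u"
proof (induction u)
  case (Cons l u)
  obtain j a where l: "l = (j, a)" by force
  have "monom 1 n - 1 dvd letter_poly ((i + j) mod n, a) - monom 1 i * letter_poly (j, a)"
    using monom_mod_dvd[of n "i + j"] 
      dvd_minus_iff[of "monom 1 n - 1" "monom 1 ((i + j) mod n) - monom 1 (i + j) :: int poly"]
    by (cases a) (auto simp: mult_monom)
  from dvd_add[OF this Cons.IH] show ?case
    by (simp add: l shift_word_def algebra_simps)
qed (simp add: shift_word_def)

text \<open>The inverse of the isomorphism induced by \<open>h\<close> sends the class of a word to its exponent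
  polynomial modulo the ideal, which identifies the kernel.\<close>

lemma cyclically_presented_ab_hom:
  assumes n: "n > 0" and w: "w \<in> carrier (free_group {..<n})"
  obtains h where "h \<in> hom poly_group (abelianization (cyclically_presented_group n w))"
    "range h = carrier (abelianization (cyclically_presented_group n w))"
    "kernel poly_group (abelianization (cyclically_presented_group n w)) h = cyc_ideal n (word_poly w)"
proof -
  define R where "R = (\<lambda>i. shift_word n i w) ` {..<n}"
  define Ab where "Ab = abelianization (presented_group {..<n} R)"
  define I where "I = cyc_ideal n (word_poly w)"
  define c where "c = ab_class {..<n} R"
  have R: "R \<subseteq> carrier (free_group {..<n})"
    using shift_word_carrier[OF w] by (auto simp: R_def)
  interpret Q: comm_group poly_group by (rule comm_group_poly_group)
  interpret Ab: comm_group Ab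
    unfolding Ab_def by (rule group.comm_group_abelianization[OF group_presented_group[OF R]])
  interpret c: group_hom "free_group {..<n}" Ab c
    using ab_class_hom[OF R] group_free_group
    by (simp add: group_hom_def group_hom_axioms_def Ab_def[symmetric] c_def)
  have gen: "free_gen (k mod n) \<in> carrier (free_group {..<n})" for k
    using n by (simp add: free_gen_def free_group_def)
  obtain h where h: "h \<in> hom poly_group Ab" "\<And>k. h (monom 1 k) = c (free_gen (k mod n))"
    using hom_poly_group_exists[OF Ab.comm_group_axioms, of "\<lambda>k. c (free_gen (k mod n))"] gen
    by (metis c.hom_closed)
  interpret h: group_hom poly_group Ab h
    using h(1) by (simp add: group_hom_def group_hom_axioms_def Ab.is_group)
  have h_diff: "h (p - q) = h p \<otimes>\<^bsub>Ab\<^esub> inv\<^bsub>Ab\<^esub> h q" for p q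
    using h.hom_mult[of p "- q"] h.hom_inv[of q] by simp
  have h_word: "h (word_poly u) = c u" if "u \<in> carrier (free_group {..<n})" for u
  proof -
    have "(h \<circ> word_poly) u = c u"
      by (rule hom_free_group_eqI[OF Ab.is_group hom_compose[OF word_poly_hom h(1)] c.homh])
        (use that in \<open>simp_all add: h(2) free_gen_def\<close>)
    then show ?thesis by simp
  qed
  \<comment> \<open>On monomials \<open>h\<close> sees exponents only mod \<open>n\<close>, so
    multiplying the argument by t^n changes nothing.\<close>
  have h_cyc: "h p = h q" if dvd: "monom 1 n - 1 dvd p - q" for p q
  proof -
    obtain a where a: "p - q = (monom 1 n - 1) * a"
      using dvd by blast
    have "h (monom 1 n * a) = h a"
    proof (rule hom_poly_group_eqI[where h = "\<lambda>p. h (monom 1 n * p)" and g = h])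
      show "(\<lambda>p. h (monom 1 n * p)) \<in> hom poly_group Ab"
        using h.hom_mult by (intro homI) (simp_all add: distrib_left)
    qed (simp_all add: h mult_monom Ab.is_group)
    then have "h (p - q) = \<one>\<^bsub>Ab\<^esub>"
      unfolding a by (simp add: left_diff_distrib h_diff)
    then show ?thesis
      by (metis h_diff Ab.inv_closed Ab.inv_inv Ab.inv_equality h.hom_closed poly_group_simps(1) UNIV_I)
  qed
  have h_shift: "h (monom 1 k * word_poly w) = \<one>\<^bsub>Ab\<^esub>" for k
  proof -
    \<comment> \<open>The relators are indexed by \<open>i < n\<close>, while the exponent
      \<open>k\<close> is arbitrary.\<close>
    have "shift_word n k w = shift_word n (k mod n) w"
      by (simp add: shift_word_def mod_simps)
    then have mem: "shift_word n k w \<in> R"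
      using n by (auto simp: R_def)
    have "h (monom 1 k * word_poly w) = h (word_poly (shift_word n k w))"
      by (rule h_cyc[symmetric]) (rule word_poly_shift_dvd)
    also have "\<dots> = \<one>\<^bsub>Ab\<^esub>"
      using h_word[of "shift_word n k w"] ab_class_relator[OF R mem] mem R
      by (auto simp: c_def Ab_def)
    finally show ?thesis .
  qed
  have h_ideal: "h p = \<one>\<^bsub>Ab\<^esub>" if p: "p \<in> I" for p
  proof -
    obtain a b where ab: "p = a * (monom 1 n - 1) + b * word_poly w"
      using p unfolding I_def cyc_ideal_def by blast
    then have "h p = h (b * word_poly w)"
      by (intro h_cyc) simp
    also have "\<dots> = \<one>\<^bsub>Ab\<^esub>"
    \<comment> \<open>The expression is additive in the cofactor \<open>b\<close>, so
      \<open>h_shift\<close> for monomial cofactors is enough.\<close>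
    proof (rule hom_poly_group_eqI[where h = "\<lambda>p. h (p * word_poly w)" and g = "\<lambda>_. \<one>\<^bsub>Ab\<^esub>"])
      show "(\<lambda>p. h (p * word_poly w)) \<in> hom poly_group Ab"
        using h.hom_mult by (intro homI) (simp_all add: distrib_right)
      show "(\<lambda>_. \<one>\<^bsub>Ab\<^esub>) \<in> hom poly_group Ab"
        by (intro homI) simp_all
    qed (simp_all add: h_shift Ab.is_group)
    finally show ?thesis .
  qed
  have surj: "range h = carrier Ab"
  proof (intro equalityI subsetI)
    fix y assume "y \<in> carrier Ab"
    then obtain u where "u \<in> carrier (free_group {..<n})" "y = c u"
      using ab_class_surj[OF R] by (auto simp: Ab_def c_def)
    then show "y \<in> range h"
      using h_word[of u] by (metis rangeI)
  qed (use h.hom_closed in auto)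
  have I: "subgroup I poly_group"
    unfolding I_def by (rule subgroup_cyc_ideal)
  interpret I: normal I poly_group
    by (rule Q.subgroup_imp_normal[OF I])
  interpret QI: comm_group "poly_group Mod I"
    by (rule Q.abelian_FactGroup[OF I])
  let ?pr = "\<lambda>p. I #>\<^bsub>poly_group\<^esub> p"
  have pr: "?pr \<in> hom poly_group (poly_group Mod I)"
    by (rule I.r_coset_hom_Mod)
  have pr_one: "?pr p = \<one>\<^bsub>poly_group Mod I\<^esub> \<longleftrightarrow> p \<in> I" for p
    using Q.rcos_self[of p I] Q.coset_join2[of p I] I by auto
  have pr_cyc: "?pr p = ?pr q" if dvd: "monom 1 n - 1 dvd p - q" for p q
  proof -
    from dvd have "p - q \<in> I"
      using cyc_ideal_mult[OF gens_in_cyc_ideal(2)] unfolding I_def by (metis dvdE mult.commute)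
    then have "p \<in> ?pr q"
      by (auto simp: r_coset_def intro!: bexI[of _ "p - q"])
    then show ?thesis
      using Q.repr_independence[of p I q] I by simp
  qed
  have rel: "?pr (word_poly u) = \<one>\<^bsub>poly_group Mod I\<^esub>" if u: "u \<in> R" for u
  proof -
    obtain i where "u = shift_word n i w"
      using u by (auto simp: R_def)
    then have "?pr (word_poly u) = ?pr (monom 1 i * word_poly w)"
      by (simp add: pr_cyc[OF word_poly_shift_dvd])
    also have "\<dots> = \<one>\<^bsub>poly_group Mod I\<^esub>"
      unfolding pr_one unfolding I_def by (intro cyc_ideal_mult gens_in_cyc_ideal)
    finally show ?thesis .
  qed
  obtain g where g: "g \<in> hom Ab (poly_group Mod I)"
    "\<And>u. u \<in> carrier (free_group {..<n}) \<Longrightarrow> g (c u) = ?pr (word_poly u)"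
    using abelianization_lift[OF R QI.comm_group_axioms hom_compose[OF word_poly_hom pr]] rel
    by (auto simp: Ab_def c_def)
  \<comment> \<open>Since \<open>g\<close> recovers \<open>p\<close> modulo \<open>I\<close> from
    \<open>h p\<close>, a trivial \<open>h p\<close> forces \<open>p\<close> into
    \<open>I\<close>.\<close>
  have gh: "g (h p) = ?pr p" for p
  proof (rule hom_poly_group_eqI[where h = "\<lambda>p. g (h p)" and g = ?pr, OF QI.is_group _ pr])
    show "(\<lambda>p. g (h p)) \<in> hom poly_group (poly_group Mod I)"
      using hom_compose[OF h(1) g(1)] by (simp add: comp_def)
    fix k
    have "g (h (monom 1 k)) = ?pr (monom 1 (k mod n))"
      using g(2)[OF gen] by (simp add: h(2) free_gen_def)
    also have "\<dots> = ?pr (monom 1 k)"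
      by (rule pr_cyc[OF monom_mod_dvd])
    finally show "g (h (monom 1 k)) = ?pr (monom 1 k)" .
  qed
  have "p \<in> I" if "h p = \<one>\<^bsub>Ab\<^esub>" for p
    using gh[of p] hom_one[OF g(1) Ab.is_group QI.is_group] by (simp add: that pr_one[symmetric])
  with h_ideal have "kernel poly_group Ab h = I"
    by (auto simp: kernel_def)
  with h(1) surj show thesis
    unfolding Ab_def I_def R_def by (intro that) (simp_all add: cyclically_presented_group_def)
qed

section \<open>The polynomial of a generalized Fibonacci group\<close>

text \<open>The exponents are deliberately not reduced mod \<open>n\<close>: the coefficients form
  two blocks of constant sign, which makes the sections easy to read off.\<close>

definition fib_poly :: "nat \<Rightarrow> nat \<Rightarrow> int poly" where
  "fib_poly r s = (\<Sum>j<r. monom 1 j) - (\<Sum>j\<in>{r..<r + s}. monom 1 j)"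

lemma coeff_fib_poly:
  "coeff (fib_poly r s) k = (if k < r then 1 else if k < r + s then -1 else 0)"
  by (simp add: fib_poly_def coeff_sum)

lemma poly_fib_poly_1: "poly (fib_poly r s) 1 = int r - int s"
  by (simp add: fib_poly_def poly_sum poly_monom)

text \<open>The boundaries of the coefficient blocks are multiples of \<open>d\<close>, so whether
  \<open>k * d + j\<close> lies below one depends on \<open>k\<close> alone.\<close>

lemma section_poly_fib_poly:
  assumes "j < d"
  shows "section_poly d j (fib_poly (r * d) (s * d)) = fib_poly r s"
proof (rule poly_eqI)
  fix k
  have less: "k * d + j < m * d \<longleftrightarrow> k < m" for m
    using assms by (auto simp flip: div_less_iff_less_mult)
  from assms have "d > 0" by simp
  then show "coeff (section_poly d j (fib_poly (r * d) (s * d))) k = coeff (fib_poly r s) k"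
    using less[of r] less[of "r + s"]
    by (simp add: coeff_section_poly coeff_fib_poly add_mult_distrib)
qed

lemma word_poly_fibonacci_word_dvd:
  assumes "n > 0"
  shows "monom 1 n - 1 dvd word_poly (fibonacci_word r n s) - fib_poly r s"
proof -
  interpret F: group "free_group {..<n}" by (rule group_free_group)
  interpret h: group_hom "free_group {..<n}" poly_group word_poly
    using word_poly_hom by (simp add: group_hom_def group_hom_axioms_def group_free_group)
  have gen: "free_gen (j mod n) \<in> carrier (free_group {..<n})" for j
    using assms by (simp add: free_gen_def free_group_def)
  have gen_prod: "gen_prod n js \<in> carrier (free_group {..<n}) \<and>
      word_poly (gen_prod n js) = sum_list (map (\<lambda>j. monom 1 (j mod n)) js)" for js
    by (induction js)
      (use gen h.hom_one in \<open>auto simp: gen_prod_def h.hom_mult free_gen_def\<close>)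
  have "word_poly (fibonacci_word r n s) - fib_poly r s
      = (\<Sum>j<r. monom 1 (j mod n) - monom 1 j)
        - (\<Sum>j\<in>{r..<r + s}. monom 1 (j mod n) - monom 1 j)"
    unfolding fibonacci_word_def fib_poly_def
    using gen_prod
    by (simp add: h.hom_mult h.hom_inv interv_sum_list_conv_sum_set_nat sum_subtractf
        atLeast0LessThan)
  then show ?thesis
    by (simp add: dvd_diff dvd_sum monom_mod_dvd)
qed

lemma gen_fibonacci_group_ab_hom:
  assumes "n > 0"
  obtains h where "h \<in> hom poly_group (abelianization (gen_fibonacci_group r n s))"
    "range h = carrier (abelianization (gen_fibonacci_group r n s))"
    "kernel poly_group (abelianization (gen_fibonacci_group r n s)) h = cyc_ideal n (fib_poly r s)"
  using cyclically_presented_ab_hom[OF assms fibonacci_word_carrier[OF assms, of r s]]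
    cyc_ideal_cong[OF word_poly_fibonacci_word_dvd[OF assms, of r s]]
  unfolding gen_fibonacci_group_def by metis

section \<open>The direct sum decomposition\<close>

theorem theorem4p7:
  fixes r n s d R N S :: nat
  assumes "n \<ge> 2" and "s > r" and "r \<ge> 1"
    and "d = gcd r (gcd n s)"
    and "R = r div d" and "N = n div d" and "S = s div d"
    and "S - R = 1"
  shows "abelianization (gen_fibonacci_group r n s) \<cong>
    sum_group {..<d} (\<lambda>_. abelianization (gen_fibonacci_group R N S))
      \<times>\<times> sum_group {..<d - 1} (\<lambda>_. integer_group)"
proof -
  define F where "F = fib_poly R S"
  define Ab where "Ab = abelianization (gen_fibonacci_group R N S)"
  define K where "K = sum_group {..<d} (\<lambda>_. Ab) \<times>\<times> sum_group {..<d - 1} (\<lambda>_. integer_group)"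
  have d: "d > 0" and dvd: "d dvd r" "d dvd n" "d dvd s"
    using assms(3) unfolding assms(4) by (auto intro: dvd_trans[OF gcd_dvd2])
  then have mult: "r = R * d" "n = N * d" "s = S * d"
    using assms by simp_all
  have n: "n > 0" and N: "N > 0"
    using assms(1) mult(2) by (auto intro: gr0I)
  \<comment> \<open>The subtraction in \<open>S - R = 1\<close> is truncated, but the value 1 forces
    \<open>S = R + 1\<close>.\<close>
  have F1: "poly F 1 = - 1"
    using assms(8) by (simp add: F_def poly_fib_poly_1)
  have section_f: "section_poly d j (fib_poly r s) = F" if "j < d" for j
    using section_poly_fib_poly[OF that, of R S] by (simp add: F_def mult)
  obtain h where h: "h \<in> hom poly_group Ab" "range h = carrier Ab"
    "kernel poly_group Ab h = cyc_ideal N F"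
    using gen_fibonacci_group_ab_hom[OF N] unfolding Ab_def F_def by metis
  have Ab: "group Ab"
    unfolding Ab_def
    by (intro comm_group.axioms(2) group.comm_group_abelianization group_gen_fibonacci_group N)
  have K: "group K"
    unfolding K_def by (intro DirProd_group sum_group Ab group_integer_group)
  \<comment> \<open>The index sets are finite, so the finite support condition in
    \<open>sum_group\<close> excludes nothing.\<close>
  have carrier_K: "carrier K = ({..<d} \<rightarrow>\<^sub>E carrier Ab) \<times> ({..<d - 1} \<rightarrow>\<^sub>E UNIV)"
    by (simp add: K_def carrier_sum_group Ab)
  interpret h: group_hom poly_group Ab h
    using h(1) Ab by (simp add: group_hom_def group_hom_axioms_def)
  have h_eq_one: "h p = \<one>\<^bsub>Ab\<^esub> \<longleftrightarrow> p \<in> cyc_ideal N F" for p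
    using h(3) by (auto simp: kernel_def)
  \<comment> \<open>The last section serves as base point, so \<open>d\<close> values at 1 give
    \<open>d - 1\<close> differences.\<close>
  define \<Phi> where "\<Phi> p = ((\<lambda>j\<in>{..<d}. h (section_poly d j p)),
    (\<lambda>j\<in>{..<d - 1}. poly (section_poly d j p) 1 - poly (section_poly d (d - 1) p) 1))" for p
  have hom: "\<Phi> \<in> hom poly_group K"
  proof (rule homI)
    show "\<Phi> p \<in> carrier K" for p
      using h.hom_closed by (auto simp: \<Phi>_def carrier_K)
    show "\<Phi> (p \<otimes>\<^bsub>poly_group\<^esub> q) = \<Phi> p \<otimes>\<^bsub>K\<^esub> \<Phi> q" for p q
      using h.hom_mult
      by (auto simp: \<Phi>_def K_def section_poly_add[OF d] intro!: restrict_ext)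
  qed
  interpret \<Phi>: group_hom poly_group K \<Phi>
    using hom K by (simp add: group_hom_def group_hom_axioms_def)
  have surj: "range \<Phi> = carrier K"
  proof (intro equalityI subsetI)
    fix z assume "z \<in> carrier K"
    then obtain x y where z: "z = (x, y)" and x: "x \<in> {..<d} \<rightarrow>\<^sub>E carrier Ab"
      and y: "y \<in> {..<d - 1} \<rightarrow>\<^sub>E UNIV"
      unfolding carrier_K by blast
    have "\<exists>q. h q = x j" if "j < d" for j
      using x that h(2) by (metis PiE_mem lessThan_iff rangeE)
    then obtain q where q: "\<And>j. j < d \<Longrightarrow> h (q j) = x j"
      by metis
    \<comment> \<open>The target values at 1, normalized to 0 at the base point
      \<open>d - 1\<close>.\<close>
    define v where "v j = (if j < d - 1 then y j else 0)" for j
    \<comment> \<open>Adding \<open>[:a:] * F\<close> keeps the class under \<open>h\<close> and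
      lowers the value at 1 by \<open>a\<close>, since F(1) = -1; this \<open>a\<close> moves the
      value of \<open>q j\<close> to \<open>v j\<close>.\<close>
    define P where "P j = q j + [:poly (q j) 1 - v j:] * F" for j
    obtain p where p: "\<And>j. j < d \<Longrightarrow> section_poly d j p = P j"
      using section_poly_surj[OF d] by blast
    have "h ([:a:] * F) = \<one>\<^bsub>Ab\<^esub>" for a
      unfolding h_eq_one by (intro cyc_ideal_mult gens_in_cyc_ideal)
    then have hP: "h (P j) = x j" if "j < d" for j
      using h.hom_mult[of "q j" "[:poly (q j) 1 - v j:] * F"] q[OF that] PiE_mem[OF x, of j] that
      by (simp add: P_def)
    have "poly (P j) 1 = v j" for j
      by (simp add: P_def F1)
    with p hP d have "\<Phi> p = z"
      using x y unfolding z \<Phi>_def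
      by (auto simp: v_def PiE_iff extensional_def fun_eq_iff)
    then show "z \<in> range \<Phi>" by blast
  qed (use \<Phi>.hom_closed in auto)
  have "\<Phi> p = \<one>\<^bsub>K\<^esub> \<longleftrightarrow> p \<in> cyc_ideal n (fib_poly r s)" for p
  proof -
    have "\<Phi> p = \<one>\<^bsub>K\<^esub> \<longleftrightarrow> (\<forall>j<d. section_poly d j p \<in> cyc_ideal N F) \<and>
        (\<forall>j<d - 1. poly (section_poly d j p) 1 = poly (section_poly d (d - 1) p) 1)"
      by (auto simp: \<Phi>_def K_def restrict_def fun_eq_iff h_eq_one)
    also have "\<dots> \<longleftrightarrow> (\<exists>c. \<forall>j<d. section_poly d j p \<in> cyc_ideal N F \<and> poly (section_poly d j p) 1 = c)"
    proof -
      have "j < d \<longleftrightarrow> j < d - 1 \<or> j = d - 1" for j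
        using d by auto
      then show ?thesis by metis
    qed
    also have "\<dots> \<longleftrightarrow> p \<in> cyc_ideal n (fib_poly r s)"
      unfolding mult(2) by (rule cyc_ideal_sections_iff[OF d section_f F1, symmetric])
    finally show ?thesis .
  qed
  then have ker: "kernel poly_group K \<Phi> = cyc_ideal n (fib_poly r s)"
    by (auto simp: kernel_def)
  obtain g where g: "g \<in> hom poly_group (abelianization (gen_fibonacci_group r n s))"
    "range g = carrier (abelianization (gen_fibonacci_group r n s))"
    "kernel poly_group (abelianization (gen_fibonacci_group r n s)) g = cyc_ideal n (fib_poly r s)"
    using gen_fibonacci_group_ab_hom[OF n] by metis
  have grp: "group (abelianization (gen_fibonacci_group r n s))"
    by (intro comm_group.axioms(2) group.comm_group_abelianization group_gen_fibonacci_group n)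
  interpret g: group_hom poly_group "abelianization (gen_fibonacci_group r n s)" g
    using g(1) grp by (simp add: group_hom_def group_hom_axioms_def)
  \<comment> \<open>Both \<open>g\<close> and \<open>\<Phi>\<close> are onto with the same kernel,
    so both targets are the same quotient of Z[t].\<close>
  have "poly_group Mod cyc_ideal n (fib_poly r s) \<cong> abelianization (gen_fibonacci_group r n s)"
    using g.FactGroup_iso g(2,3) by simp
  moreover have "poly_group Mod cyc_ideal n (fib_poly r s) \<cong> K"
    using \<Phi>.FactGroup_iso surj ker by simp
  moreover have "group (poly_group Mod cyc_ideal n (fib_poly r s))"
    using \<Phi>.normal_kernel ker normal.factorgroup_is_group by metis
  ultimately show ?thesis
    unfolding K_def Ab_def by (metis group.iso_sym iso_trans)
qed

end
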